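(* Let $q$ be a prime power and let $C$ be an $[n,k]_q$ code of full length, with $k\ge 1$. Write $d_r=d_r(C)$ and $\delta_r=\delta_r(C)$. Then $$n=g_q^{(k)}(k,d_k)\ge g_q^{(k-1)}(k,d_{k-1})\ge\cdots\ge g_q^{(1)}(k,d_1),$$ $$n=a_q^{(k)}(k,\delta_k)\le a_q^{(k-1)}(k,\delta_{k-1})\le\cdots\le a_q^{(1)}(k,\delta_1).$$ Therefore, for every $1\le r\le k$, $$n\ge d_r+\sum_{i=1}^{k-r}\left\lceil\frac{d_r}{q^i{r\brack 1}_q}\right\rceil,\qquad n\le \delta_r+\sum_{i=1}^{k-r}\left\lfloor\frac{\delta_r}{q^i{r\brack 1}_q}\right\rfloor.$$
   Context: An $[n,k]_q$ code is a $k$-dimensional linear subspace $C\le\mathbb{F}_q^n$. For a subcode (linear subspace) $A\le C$, $\mathrm{supp}(A)$ is the set of coordinates $j$ such that $a_j\neq 0$ for some $a\in A$, and $w(A)=|\mathrm{supp}(A)|$. $C$ has full length if $w(C)=n$, i.e. no coordinate is identically zero on $C$. For $1\le r\le k$, $d_r(C)$ and $\delta_r(C)$ are respectively the minimum and the maximum of $w(A)$ over all $r$-dimensional subcodes $A\le C$. Put ${r\brack 1}_q=(q^r-1)/(q-1)$. For an integer $x\ge 0$ and $1\le r\le k$, $$g_q^{(r)}(k,x)=x+\sum_{i=1}^{k-r}\left\lceil\frac{x}{q^i{r\brack 1}_q}\right\rceil,\qquad a_q^{(r)}(k,x)=x+\sum_{i=1}^{k-r}\left\lfloor\frac{x}{q^i{r\brack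 1}_q}\right\rfloor,$$ where empty sums are zero. *)

theory Defs
  imports "HOL-Analysis.Cartesian_Space" "HOL-Number_Theory.Prime_Powers"
begin

text \<open>
  The field with \<open>q\<close> elements is a type \<open>'a\<close> of sort \<open>{finite, field}\<close> with \<open>CARD('a) = q\<close>,
  and its \<open>n\<close>-dimensional coordinate space is \<open>'a ^ 'n\<close> with \<open>CARD('n) = n\<close>.
  Length zero is excluded by this representation, but no code of dimension \<open>k \<ge> 1\<close> has length
  zero.  The prefix \<open>vec\<close> refers to the vector space structure of \<open>'a ^ 'n\<close> over \<open>'a\<close>.
\<close>

definition linear_code :: "nat \<Rightarrow> nat \<Rightarrow> nat \<Rightarrow> ('a::{finite,field} ^ 'n::finite) set \<Rightarrow> bool" where
  "linear_code q n k C \<longleftrightarrow>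
     CARD('a) = q \<and> CARD('n) = n \<and> vec.subspace C \<and> vec.dim C = k"

definition code_supp :: "('a::{finite,field} ^ 'n::finite) set \<Rightarrow> 'n set" where
  "code_supp A = {j. \<exists>a\<in>A. a $ j \<noteq> 0}"

definition code_weight :: "('a::{finite,field} ^ 'n::finite) set \<Rightarrow> nat" where
  "code_weight A = card (code_supp A)"

definition full_length :: "('a::{finite,field} ^ 'n::finite) set \<Rightarrow> bool" where
  "full_length C \<longleftrightarrow> code_weight C = CARD('n)"

definition subcodes :: "nat \<Rightarrow> ('a::{finite,field} ^ 'n::finite) set \<Rightarrow> ('a ^ 'n) set set" where
  "subcodes r C = {A. A \<subseteq> C \<and> vec.subspace A \<and> vec.dim A = r}"

text \<open>
  \<open>Min\<close> and \<open>Max\<close> are taken over a finite set, which is nonempty exactly when \<open>r\<close> is at most the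
  dimension of the code \<open>C\<close>; otherwise the two values below are unspecified.
\<close>

definition min_subcode_weight :: "nat \<Rightarrow> ('a::{finite,field} ^ 'n::finite) set \<Rightarrow> nat" where
  "min_subcode_weight r C = Min (code_weight ` subcodes r C)"

definition max_subcode_weight :: "nat \<Rightarrow> ('a::{finite,field} ^ 'n::finite) set \<Rightarrow> nat" where
  "max_subcode_weight r C = Max (code_weight ` subcodes r C)"

definition q_bracket :: "nat \<Rightarrow> nat \<Rightarrow> real" where
  "q_bracket q r = (real q ^ r - 1) / (real q - 1)"

text \<open>
  In the next two definitions the truncated subtraction \<open>k - r\<close> is harmless for \<open>r \<le> k\<close>, the only
  case of interest.
\<close>

definition g_bound :: "nat \<Rightarrow> nat \<Rightarrow> nat \<Rightarrow> nat \<Rightarrow> int" where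
  "g_bound q r k x = int x + (\<Sum>i = 1..k - r. \<lceil>real x / (real q ^ i * q_bracket q r)\<rceil>)"

definition a_bound :: "nat \<Rightarrow> nat \<Rightarrow> nat \<Rightarrow> nat \<Rightarrow> int" where
  "a_bound q r k x = int x + (\<Sum>i = 1..k - r. \<lfloor>real x / (real q ^ i * q_bracket q r)\<rfloor>)"

end

theory Submission
  imports Defs
begin

text \<open>
  Averaging over hyperplanes drives everything.  Let \<open>A\<close> have dimension \<open>m\<close>.  Each coordinate \<open>j\<close> in
  the support of \<open>A\<close> restricts to a nonzero functional on \<open>A\<close>, and \<open>j\<close> leaves the support of a
  hyperplane exactly when that hyperplane is the kernel of this functional.  Summing weights over the
  kernels of all \<open>q\<^sup>m - 1\<close> nonzero functionals gives \<open>w(A) (q\<^sup>m - q)\<close>, so with \<open>m = r + 1\<close> some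
  hyperplane lies below and some above the mean, whence
  \<open>d\<^sub>r / (q [r]) \<le> d\<^sub>r\<^sub>+\<^sub>1 / [r+1]\<close> and \<open>\<delta>\<^sub>r / (q [r]) \<ge> \<delta>\<^sub>r\<^sub>+\<^sub>1 / [r+1]\<close>.  Since \<open>[r+1] = 1 + q [r]\<close>,
  the first two terms of the bound for \<open>r\<close> compare with the first term for \<open>r + 1\<close>, and the remaining
  terms compare one by one after an index shift.
\<close>

section \<open>Hyperplanes as kernels of functionals, and their average weight\<close>

text \<open>Subtracting from \<open>a\<close> the multiple of \<open>u\<close> on which
  \<open>f\<close> has the same value lands in the kernel, so \<open>A\<close> is spanned by
  \<open>K\<close> and the one extra vector \<open>u\<close>. Linearity is asked only on
  \<open>A\<close> because the functionals used later come from \<open>vec.representation\<close>,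
  which defaults to 0 off the span of the basis.\<close>

lemma functional_kernel:
  fixes A :: "('a::field ^ 'n::finite) set" and f :: "'a ^ 'n \<Rightarrow> 'a"
  assumes A: "vec.subspace A"
    and add: "\<And>x y. x \<in> A \<Longrightarrow> y \<in> A \<Longrightarrow> f (x + y) = f x + f y"
    and scale: "\<And>s x. x \<in> A \<Longrightarrow> f (s *s x) = s * f x"
    and u: "u \<in> A" "f u \<noteq> 0"
  defines "K \<equiv> {a \<in> A. f a = 0}"
  shows "vec.subspace K" and "Suc (vec.dim K) = vec.dim A"
    and "a \<in> A \<Longrightarrow> a - (f a / f u) *s u \<in> K"
proof -
  have f0: "f 0 = 0"
    using scale[of u 0] u by simp
  show sub: "vec.subspace K"
    using A by (auto simp: vec.subspace_def K_def add scale f0)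
  have proj: "a - (f a / f u) *s u \<in> K" if "a \<in> A" for a
  proof -
    have su: "(- (f a / f u)) *s u \<in> A"
      using A u by (simp only: vec.subspace_scale)
    have "a + (- (f a / f u)) *s u \<in> A"
      using that su A by (rule_tac vec.subspace_add)
    moreover have "f (a + (- (f a / f u)) *s u) = 0"
      using add[OF that su] scale[OF u(1), of "- (f a / f u)"] u by simp
    ultimately have "a + (- (f a / f u)) *s u \<in> K"
      by (simp add: K_def)
    then show ?thesis by simp
  qed
  then show "a \<in> A \<Longrightarrow> a - (f a / f u) *s u \<in> K" .
  have "u \<notin> K"
    using u by (simp add: K_def)
  then have "u \<notin> vec.span K"
    using sub by (metis vec.span_eq_iff)
  moreover have "vec.span (insert u K) = A"
  proof
    have "insert u K \<subseteq> A" using u by (auto simp: K_def)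
    then show "vec.span (insert u K) \<subseteq> A" using A by (simp add: vec.span_minimal)
    show "A \<subseteq> vec.span (insert u K)"
      using proj by (auto simp: vec.span_insert intro: vec.span_base)
  qed
  ultimately show "Suc (vec.dim K) = vec.dim A"
    using vec.dim_insert[of u K] vec.dim_span[of "insert u K"] by simp
qed

lemma span_coord_eq_0:
  fixes S :: "('a::field ^ 'n::finite) set"
  assumes "\<And>b. b \<in> S \<Longrightarrow> b $ j = 0" and "a \<in> vec.span S"
  shows "a $ j = 0"
  using assms(2) by (induction rule: vec.span_induct_alt) (auto simp: assms(1))

text \<open>The mean runs over nonzero functionals instead of hyperplanes: each kernel is shared by
  the \<open>q - 1\<close> nonzero multiples of one functional, so the mean is unchanged and no
  separate count of hyperplanes is needed.\<close>

lemma exists_subcodes_around_average: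
  fixes A :: "('a::{finite,field} ^ 'n::finite) set"
  defines "q \<equiv> CARD('a)"
  assumes A: "vec.subspace A" and dim: "vec.dim A = Suc r"
  shows "\<exists>B\<in>subcodes r A. code_weight B * (q ^ Suc r - 1) \<le> code_weight A * (q ^ Suc r - q)"
    and "\<exists>B\<in>subcodes r A. code_weight A * (q ^ Suc r - q) \<le> code_weight B * (q ^ Suc r - 1)"
proof -
  obtain S where S: "S \<subseteq> A" "vec.independent S" "A \<subseteq> vec.span S" "card S = Suc r"
    using vec.basis_exists[of A] dim by metis
  have spanS: "vec.span S = A"
    using S A vec.span_minimal by blast
  \<comment> \<open>\<open>\<phi> c\<close> is the functional on \<open>A\<close> with value
    \<open>c b\<close> at each basis vector \<open>b\<close>. \<open>P\<close> holds one extensional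
    coefficient tuple per nonzero functional.\<close>
  define \<phi> where "\<phi> c a = (\<Sum>b\<in>S. c b * vec.representation S a b)" for c :: "'a ^ 'n \<Rightarrow> 'a" and a
  define P where "P = (S \<rightarrow>\<^sub>E (UNIV :: 'a set)) - {\<lambda>b\<in>S. 0}"
  define K where "K c = {a \<in> A. \<phi> c a = 0}" for c
  have finP: "finite P" by (simp add: P_def finite_PiE)
  have cardP: "card P = q ^ Suc r - 1"
    unfolding P_def q_def using S(4) by (subst card_Diff_singleton) (auto simp: card_PiE)
  have \<phi>_add: "\<phi> c (x + y) = \<phi> c x + \<phi> c y" if "x \<in> A" "y \<in> A" for c x y
    using that S(2) spanS
    by (simp add: \<phi>_def vec.representation_add distrib_left sum.distrib)
  have \<phi>_scale: "\<phi> c (s *s x) = s * \<phi> c x" if "x \<in> A" for c s x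
    using that S(2) spanS
    by (simp add: \<phi>_def vec.representation_scale sum_distrib_left mult.left_commute)
  have \<phi>_basis: "\<phi> c b = c b" if "b \<in> S" for c b
    using that by (simp add: \<phi>_def vec.representation_basis[OF S(2)] if_distrib cong: if_cong)
  have nz: "\<exists>b\<in>S. c b \<noteq> 0" if "c \<in> P" for c
    using that by (fastforce simp: P_def PiE_iff extensional_def)
  have kernel: "K c \<in> subcodes r A"
    and kernel_proj: "b \<in> S \<Longrightarrow> c b \<noteq> 0 \<Longrightarrow> a \<in> A \<Longrightarrow> a - (\<phi> c a / c b) *s b \<in> K c" if "c \<in> P" for c a b
  proof -
    obtain b' where b': "b' \<in> S" "c b' \<noteq> 0" using nz[OF \<open>c \<in> P\<close>] by blast
    note k = functional_kernel[of A "\<phi> c", OF A \<phi>_add \<phi>_scale, folded K_def]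
    show "K c \<in> subcodes r A"
      using k(1,2)[of b'] b' S(1) dim by (auto simp: subcodes_def \<phi>_basis K_def)
    show "a - (\<phi> c a / c b) *s b \<in> K c" if "b \<in> S" "c b \<noteq> 0" "a \<in> A"
      using k(3)[of b a] that S(1) by (auto simp: \<phi>_basis)
  qed
  \<comment> \<open>The functionals whose kernel vanishes at \<open>j\<close> are exactly the
    nonzero multiples of the coordinate functional at \<open>j\<close>; \<open>h s\<close> is the
    coefficient tuple of \<open>s\<close> times that functional.\<close>
  have missing: "card {c \<in> P. j \<notin> code_supp (K c)} = q - 1" if j: "j \<in> code_supp A" for j
  proof -
    obtain b0 where b0: "b0 \<in> S" "b0 $ j \<noteq> 0"
      using j span_coord_eq_0[of S j] spanS by (auto simp: code_supp_def)
    define h where "h s = (\<lambda>b\<in>S. s * b $ j)" for s :: 'a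
    have inj: "inj_on h (UNIV - {0})"
    proof (rule inj_onI)
      fix s t assume "h s = h t"
      then have "h s b0 = h t b0" by simp
      then show "s = t" using b0 by (simp add: h_def)
    qed
    have "{c \<in> P. j \<notin> code_supp (K c)} = h ` (UNIV - {0})"
    proof (intro equalityI subsetI)
      fix c assume "c \<in> {c \<in> P. j \<notin> code_supp (K c)}"
      then have c: "c \<in> P" and z: "\<And>a. a \<in> K c \<Longrightarrow> a $ j = 0"
        by (auto simp: code_supp_def)
      obtain u where u: "u \<in> S" "c u \<noteq> 0" using nz c by blast
      \<comment> \<open>Projecting \<open>b\<close> along \<open>u\<close> into the kernel gives a
        vector that vanishes at \<open>j\<close>, so \<open>c\<close> is proportional to the
        \<open>j\<close>-th coordinate on \<open>S\<close>.\<close>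
      have eq: "b $ j = (c b / c u) * u $ j" if "b \<in> S" for b
        using z[OF kernel_proj[OF c u, of b]] that S(1) by (auto simp: \<phi>_basis)
      have uj: "u $ j \<noteq> 0" using eq[OF b0(1)] b0(2) by auto
      have "c = h (c u / u $ j)"
      proof
        fix b show "c b = h (c u / u $ j) b"
        proof (cases "b \<in> S")
          case True
          then show ?thesis using eq[of b] u uj by (simp add: h_def)
        next
          case False
          then show ?thesis using c by (auto simp: h_def P_def PiE_iff extensional_def)
        qed
      qed
      then show "c \<in> h ` (UNIV - {0})" using u uj by (metis DiffI UNIV_I divide_eq_0_iff image_eqI singletonD)
    next
      fix c assume "c \<in> h ` (UNIV - {0})"
      then obtain s where s: "s \<noteq> 0" "c = h s" by auto
      have "h s b0 \<noteq> (\<lambda>b\<in>S. 0) b0" using s b0 by (simp add: h_def)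
      then have "h s \<noteq> (\<lambda>b\<in>S. 0)" by metis
      then have c: "c \<in> P" using s by (simp add: P_def h_def)
      have "a $ j = 0" if a: "a \<in> K c" for a
      proof -
        have aA: "a \<in> vec.span S" using a spanS by (simp add: K_def)
        have "a $ j = (\<Sum>b\<in>S. vec.representation S a b *s b) $ j"
          using vec.sum_representation_eq[OF S(2) aA _ subset_refl] by simp
        also have "s * \<dots> = \<phi> c a"
          by (auto simp: sum_component \<phi>_def s h_def sum_distrib_left mult_ac intro!: sum.cong)
        finally show ?thesis using a s by (simp add: K_def)
      qed
      then show "c \<in> {c \<in> P. j \<notin> code_supp (K c)}" using c by (auto simp: code_supp_def)
    qed
    then show ?thesis using inj by (simp add: card_image card_Diff_singleton q_def)
  qed
  have supp_sub: "code_supp (K c) \<subseteq> code_supp A" for c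
    by (auto simp: code_supp_def K_def)
  have q1: "q \<ge> 1" by (simp add: q_def Suc_le_eq)
  have total: "(\<Sum>c\<in>P. code_weight (K c)) = code_weight A * (q ^ Suc r - q)"
  proof -
    \<comment> \<open>Double counting of the pairs of a functional \<open>c\<close> and a coordinate
      \<open>j\<close> in the support of its kernel.\<close>
    have "(\<Sum>c\<in>P. code_weight (K c)) = (\<Sum>c\<in>P. \<Sum>j\<in>code_supp A. if j \<in> code_supp (K c) then 1 else 0)"
    proof (rule sum.cong[OF refl])
      fix c
      have "code_supp (K c) = {j \<in> code_supp A. j \<in> code_supp (K c)}" using supp_sub by auto
      then show "code_weight (K c) = (\<Sum>j\<in>code_supp A. if j \<in> code_supp (K c) then 1 else 0)"
        by (simp add: code_weight_def flip: sum.inter_filter)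
    qed
    also have "\<dots> = (\<Sum>j\<in>code_supp A. card {c \<in> P. j \<in> code_supp (K c)})"
      by (subst sum.swap) (simp add: finP flip: sum.inter_filter)
    also have "\<dots> = (\<Sum>j\<in>code_supp A. q ^ Suc r - q)"
    proof (rule sum.cong[OF refl])
      fix j assume j: "j \<in> code_supp A"
      have "{c \<in> P. j \<in> code_supp (K c)} = P - {c \<in> P. j \<notin> code_supp (K c)}" by auto
      then have "card {c \<in> P. j \<in> code_supp (K c)} = card P - (q - 1)"
        using missing[OF j] finP by (simp add: card_Diff_subset)
      then show "card {c \<in> P. j \<in> code_supp (K c)} = q ^ Suc r - q"
        using cardP q1 by simp
    qed
    finally show ?thesis by (simp add: code_weight_def)
  qed
  have "\<exists>b. b \<in> S" using S(4) by (metis card.empty nat.distinct(1) ex_in_conv)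
  then obtain b where "b \<in> S" ..
  \<comment> \<open>\<open>P\<close> must be nonempty for the strict comparison of sums below; the
    all-ones tuple is a witness since \<open>S\<close> is nonempty.\<close>
  then have "(\<lambda>b\<in>S. 1) \<in> P" by (auto simp: P_def fun_eq_iff)
  then have neP: "P \<noteq> {}" by auto
  show "\<exists>B\<in>subcodes r A. code_weight B * (q ^ Suc r - 1) \<le> code_weight A * (q ^ Suc r - q)"
  proof (rule ccontr)
    assume "\<not> ?thesis"
    then have *: "code_weight A * (q ^ Suc r - q) < code_weight (K c) * (q ^ Suc r - 1)" if "c \<in> P" for c
      using kernel[OF that] by (auto simp: not_le)
    have "(\<Sum>c\<in>P. code_weight A * (q ^ Suc r - q)) < (\<Sum>c\<in>P. code_weight (K c) * (q ^ Suc r - 1))"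
      using * finP neP by (intro sum_strict_mono) auto
    then show False
      using total cardP by (simp flip: sum_distrib_right)
  qed
  show "\<exists>B\<in>subcodes r A. code_weight A * (q ^ Suc r - q) \<le> code_weight B * (q ^ Suc r - 1)"
  proof (rule ccontr)
    assume "\<not> ?thesis"
    then have *: "code_weight (K c) * (q ^ Suc r - 1) < code_weight A * (q ^ Suc r - q)" if "c \<in> P" for c
      using kernel[OF that] by (auto simp: not_le)
    have "(\<Sum>c\<in>P. code_weight (K c) * (q ^ Suc r - 1)) < (\<Sum>c\<in>P. code_weight A * (q ^ Suc r - q))"
      using * finP neP by (intro sum_strict_mono) auto
    then show False
      using total cardP by (simp flip: sum_distrib_right)
  qed
qed

section \<open>Extremal subcode weights in consecutive dimensions\<close>

text \<open>Any \<open>r\<close> vectors of a basis of \<open>C\<close> span such a subcode. This is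
  what makes \<open>Min\<close> and \<open>Max\<close> attained.\<close>

lemma subcodes_nonempty:
  assumes "r \<le> vec.dim C" and "vec.subspace C"
  shows "subcodes r C \<noteq> {}"
proof -
  obtain S where S: "S \<subseteq> C" "vec.independent S" "card S = vec.dim C"
    using vec.basis_exists[of C] by metis
  obtain T where T: "T \<subseteq> S" "card T = r"
    using S(3) assms(1) by (metis obtain_subset_with_card_n)
  have "vec.span T \<in> subcodes r C"
    using S T assms vec.span_minimal[of T C] vec.independent_mono[OF S(2) T(1)]
    by (auto simp: subcodes_def vec.dim_eq_card_independent)
  then show ?thesis by auto
qed

lemma subcodes_dim:
  assumes "vec.subspace C"
  shows "subcodes (vec.dim C) C = {C}"
  using assms by (auto simp: subcodes_def dest: vec.subspace_dim_equal)

text \<open>A light hyperplane of a lightest subcode of dimension \<open>Suc r\<close> is again a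
  subcode of \<open>C\<close>, so its weight bounds the minimum in dimension \<open>r\<close> from
  above.\<close>

lemma min_subcode_weight_step:
  fixes C :: "('a::{finite,field} ^ 'n::finite) set"
  assumes C: "vec.subspace C" and r: "Suc r \<le> vec.dim C"
  shows "min_subcode_weight r C * (CARD('a) ^ Suc r - 1)
       \<le> min_subcode_weight (Suc r) C * (CARD('a) ^ Suc r - CARD('a))"
proof -
  have "min_subcode_weight (Suc r) C \<in> code_weight ` subcodes (Suc r) C"
    unfolding min_subcode_weight_def using subcodes_nonempty[OF r C] by (intro Min_in) auto
  then obtain A where A: "A \<in> subcodes (Suc r) C" "min_subcode_weight (Suc r) C = code_weight A"
    by auto
  then obtain B where B: "B \<in> subcodes r A"
    "code_weight B * (CARD('a) ^ Suc r - 1) \<le> code_weight A * (CARD('a) ^ Suc r - CARD('a))"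
    using exists_subcodes_around_average(1)[of A r] by (auto simp: subcodes_def)
  then have "B \<in> subcodes r C" using A by (auto simp: subcodes_def)
  then have "min_subcode_weight r C \<le> code_weight B"
    unfolding min_subcode_weight_def by (intro Min_le) auto
  then have "min_subcode_weight r C * (CARD('a) ^ Suc r - 1) \<le> code_weight B * (CARD('a) ^ Suc r - 1)"
    by (rule mult_right_mono) simp
  also note B(2)
  finally show ?thesis by (simp only: A(2))
qed

text \<open>Dually, a heavy hyperplane of a heaviest subcode bounds the maximum in dimension
  \<open>r\<close> from below.\<close>

lemma max_subcode_weight_step:
  fixes C :: "('a::{finite,field} ^ 'n::finite) set"
  assumes C: "vec.subspace C" and r: "Suc r \<le> vec.dim C"
  shows "max_subcode_weight (Suc r) C * (CARD('a) ^ Suc r - CARD('a))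
       \<le> max_subcode_weight r C * (CARD('a) ^ Suc r - 1)"
proof -
  have "max_subcode_weight (Suc r) C \<in> code_weight ` subcodes (Suc r) C"
    unfolding max_subcode_weight_def using subcodes_nonempty[OF r C] by (intro Max_in) auto
  then obtain A where A: "A \<in> subcodes (Suc r) C" "max_subcode_weight (Suc r) C = code_weight A"
    by auto
  then obtain B where B: "B \<in> subcodes r A"
    "code_weight A * (CARD('a) ^ Suc r - CARD('a)) \<le> code_weight B * (CARD('a) ^ Suc r - 1)"
    using exists_subcodes_around_average(2)[of A r] by (auto simp: subcodes_def)
  then have "B \<in> subcodes r C" using A by (auto simp: subcodes_def)
  then have le: "code_weight B \<le> max_subcode_weight r C"
    unfolding max_subcode_weight_def by (intro Max_ge) auto
  note B(2)
  also have "code_weight B * (CARD('a) ^ Suc r - 1) \<le> max_subcode_weight r C * (CARD('a) ^ Suc r - 1)"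
    using le by (rule mult_right_mono) simp
  finally show ?thesis by (simp only: A(2))
qed

section \<open>Arithmetic of the rounded sums\<close>

lemma q_bracket_Suc:
  assumes "q \<ge> 2"
  shows "q_bracket q (Suc r) = 1 + real q * q_bracket q r"
proof -
  have "real q - 1 \<noteq> 0" using assms by simp
  then show ?thesis by (simp add: q_bracket_def divide_simps) (simp add: algebra_simps)
qed

lemma q_bracket_pos:
  assumes "q \<ge> 2" "r \<ge> 1"
  shows "q_bracket q r > 0"
  using assms by (auto simp: q_bracket_def intro!: divide_pos_pos one_less_power)

text \<open>Together with the next identity this turns the truncated natural factors of the
  averaging inequality into brackets; the common factor \<open>q - 1\<close> then cancels.\<close>

lemma of_nat_power_minus_one:
  assumes "q \<ge> 2"
  shows "real (q ^ r - 1) = (real q - 1) * q_bracket q r"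
  using assms by (simp add: q_bracket_def of_nat_diff)

lemma of_nat_power_Suc_minus:
  assumes "q \<ge> 2"
  shows "real (q ^ Suc r - q) = (real q - 1) * (real q * q_bracket q r)"
proof -
  have "q ^ Suc r - q = q * (q ^ r - 1)"
    by (simp add: right_diff_distrib')
  then show ?thesis
    by (simp only: of_nat_mult of_nat_power_minus_one[OF assms] mult_ac)
qed

lemma sum_shift_first:
  fixes f :: "nat \<Rightarrow> int"
  assumes "r < k"
  shows "(\<Sum>i = 1..k - r. f i) = f 1 + (\<Sum>i = 1..k - Suc r. f (Suc i))"
proof -
  have "k - r = Suc (k - Suc r)" using assms by simp
  then show ?thesis
    by (simp add: sum.atLeast_Suc_atMost sum.shift_bounds_cl_Suc_ivl del: sum.cl_ivl_Suc)
qed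

lemma g_bound_step:
  assumes q: "q \<ge> 2" and r: "1 \<le> r" "r < k"
    and le: "x * (q ^ Suc r - 1) \<le> y * (q ^ Suc r - q)"
  shows "g_bound q r k x \<le> g_bound q (Suc r) k y"
proof -
  note pos = q_bracket_pos[OF q r(1)]
  have pos': "q_bracket q (Suc r) > 0" using q_bracket_pos[OF q] by simp
  have "real x * real (q ^ Suc r - 1) \<le> real y * real (q ^ Suc r - q)"
    using le by (metis of_nat_le_iff of_nat_mult)
  then have "(real q - 1) * (real x * q_bracket q (Suc r)) \<le> (real q - 1) * (real y * (real q * q_bracket q r))"
    unfolding of_nat_power_minus_one[OF q] of_nat_power_Suc_minus[OF q] by (simp add: mult_ac)
  then have le': "real x * q_bracket q (Suc r) \<le> real y * (real q * q_bracket q r)"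
    using q by simp
  \<comment> \<open>Term \<open>i + 1\<close> of the sum for \<open>r\<close> is matched with term
    \<open>i\<close> of the sum for \<open>r + 1\<close>.\<close>
  have term_le: "real x / (real q ^ Suc i * q_bracket q r) \<le> real y / (real q ^ i * q_bracket q (Suc r))" for i
  proof -
    have "real x / (real q * q_bracket q r) \<le> real y / q_bracket q (Suc r)"
      using le' pos pos' q by (simp add: divide_simps mult_ac)
    then have "real x / (real q * q_bracket q r) / real q ^ i \<le> real y / q_bracket q (Suc r) / real q ^ i"
      by (rule divide_right_mono) simp
    then show ?thesis by (simp add: mult_ac)
  qed
  \<comment> \<open>By \<open>q_bracket_Suc\<close> this is \<open>le'\<close> divided by
    \<open>q\<close> times the bracket of \<open>r\<close>.\<close>
  have "real x + real x / (real q ^ 1 * q_bracket q r) \<le> real y"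
    using le' pos q unfolding q_bracket_Suc[OF q] by (simp add: field_simps)
  \<comment> \<open>\<open>y - x\<close> is an integer, so the fraction may be rounded up.\<close>
  then have first: "int x + \<lceil>real x / (real q ^ 1 * q_bracket q r)\<rceil> \<le> int y"
    by linarith
  have rest: "(\<Sum>i = 1..k - Suc r. \<lceil>real x / (real q ^ Suc i * q_bracket q r)\<rceil>)
      \<le> (\<Sum>i = 1..k - Suc r. \<lceil>real y / (real q ^ i * q_bracket q (Suc r))\<rceil>)"
    by (intro sum_mono ceiling_mono term_le)
  show ?thesis
    unfolding g_bound_def sum_shift_first[OF r(2)] using first rest by linarith
qed

lemma a_bound_step:
  assumes q: "q \<ge> 2" and r: "1 \<le> r" "r < k"
    and le: "y * (q ^ Suc r - q) \<le> x * (q ^ Suc r - 1)"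
  shows "a_bound q (Suc r) k y \<le> a_bound q r k x"
proof -
  note pos = q_bracket_pos[OF q r(1)]
  have pos': "q_bracket q (Suc r) > 0" using q_bracket_pos[OF q] by simp
  have "real y * real (q ^ Suc r - q) \<le> real x * real (q ^ Suc r - 1)"
    using le by (metis of_nat_le_iff of_nat_mult)
  then have "(real q - 1) * (real y * (real q * q_bracket q r)) \<le> (real q - 1) * (real x * q_bracket q (Suc r))"
    unfolding of_nat_power_minus_one[OF q] of_nat_power_Suc_minus[OF q] by (simp add: mult_ac)
  then have le': "real y * (real q * q_bracket q r) \<le> real x * q_bracket q (Suc r)"
    using q by simp
  have term_le: "real y / (real q ^ i * q_bracket q (Suc r)) \<le> real x / (real q ^ Suc i * q_bracket q r)" for i
  proof -
    have "real y / q_bracket q (Suc r) \<le> real x / (real q * q_bracket q r)"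
      using le' pos pos' q by (simp add: divide_simps mult_ac)
    then have "real y / q_bracket q (Suc r) / real q ^ i \<le> real x / (real q * q_bracket q r) / real q ^ i"
      by (rule divide_right_mono) simp
    then show ?thesis by (simp add: mult_ac)
  qed
  have "real y \<le> real x + real x / (real q ^ 1 * q_bracket q r)"
    using le' pos q unfolding q_bracket_Suc[OF q] by (simp add: field_simps)
  \<comment> \<open>Here the integer \<open>y - x\<close> lies below the fraction, hence below its
    floor.\<close>
  then have first: "int y \<le> int x + \<lfloor>real x / (real q ^ 1 * q_bracket q r)\<rfloor>"
    by linarith
  have rest: "(\<Sum>i = 1..k - Suc r. \<lfloor>real y / (real q ^ i * q_bracket q (Suc r))\<rfloor>)
      \<le> (\<Sum>i = 1..k - Suc r. \<lfloor>real x / (real q ^ Suc i * q_bracket q r)\<rfloor>)"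
    by (intro sum_mono floor_mono term_le)
  show ?thesis
    unfolding a_bound_def sum_shift_first[OF r(2)] using first rest by linarith
qed

section \<open>The two chains and the bounds on the length\<close>

theorem theorem3p3:
  fixes C :: "('a::{finite,field} ^ 'n::finite) set"
    and q n k :: nat
    and d \<delta> :: "nat \<Rightarrow> nat"
  assumes "primepow q"
    and "linear_code q n k C"
    and "full_length C"
    and "k \<ge> 1"
    and d_def: "\<And>r. d r = min_subcode_weight r C"
    and \<delta>_def: "\<And>r. \<delta> r = max_subcode_weight r C"
  shows "int n = g_bound q k k (d k)
       \<and> (\<forall>r. 1 \<le> r \<and> r < k \<longrightarrow> g_bound q (r + 1) k (d (r + 1)) \<ge> g_bound q r k (d r))
       \<and> int n = a_bound q k k (\<delta> k)
       \<and> (\<forall>r. 1 \<le> r \<and> r < k \<longrightarrow> a_bound q (r + 1) k (\<delta> (r + 1)) \<le> a_bound q r k (\<delta> r))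
       \<and> (\<forall>r. 1 \<le> r \<and> r \<le> k \<longrightarrow>
            int n \<ge> int (d r) + (\<Sum>i = 1..k - r. \<lceil>real (d r) / (real q ^ i * q_bracket q r)\<rceil>)
          \<and> int n \<le> int (\<delta> r) + (\<Sum>i = 1..k - r. \<lfloor>real (\<delta> r) / (real q ^ i * q_bracket q r)\<rfloor>))"
proof -
  have q: "q \<ge> 2"
    using assms(1) primepow_gt_Suc_0[of q] by simp
  have C: "vec.subspace C" "vec.dim C = k" and card: "CARD('a) = q" "CARD('n) = n"
    using assms(2) by (auto simp: linear_code_def)
  have weight: "code_weight C = n"
    using assms(3) card by (simp add: full_length_def)
  \<comment> \<open>The only subcode of dimension \<open>k\<close> is \<open>C\<close> itself, and
    full length gives it weight \<open>n\<close>.\<close>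
  have top: "d k = n" "\<delta> k = n"
    using subcodes_dim[OF C(1)] C(2) weight
    by (simp_all add: d_def \<delta>_def min_subcode_weight_def max_subcode_weight_def)
  have g_top: "int n = g_bound q k k (d k)" and a_top: "int n = a_bound q k k (\<delta> k)"
    by (simp_all add: g_bound_def a_bound_def top)
  have g_step: "g_bound q r k (d r) \<le> g_bound q (Suc r) k (d (Suc r))" if "1 \<le> r" "r < k" for r
    using g_bound_step[OF q that] min_subcode_weight_step[OF C(1), of r] that C(2) card
    by (simp add: d_def)
  have a_step: "a_bound q (Suc r) k (\<delta> (Suc r)) \<le> a_bound q r k (\<delta> r)" if "1 \<le> r" "r < k" for r
    using a_bound_step[OF q that] max_subcode_weight_step[OF C(1), of r] that C(2) card
    by (simp add: \<delta>_def)
  \<comment> \<open>Downward induction from \<open>r = k\<close>, where the sum is empty, composes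
    the links of the chain; \<open>a_ge\<close> is obtained in the same way.\<close>
  have g_le: "g_bound q r k (d r) \<le> int n" if "1 \<le> r" "r \<le> k" for r
    using that(2,1)
  proof (induction rule: inc_induct)
    case base
    then show ?case using g_top by simp
  next
    case (step r)
    then show ?case using g_step[of r] by simp
  qed
  have a_ge: "int n \<le> a_bound q r k (\<delta> r)" if "1 \<le> r" "r \<le> k" for r
    using that(2,1)
  proof (induction rule: inc_induct)
    case base
    then show ?case using a_top by simp
  next
    case (step r)
    then show ?case using a_step[of r] by simp
  qed
  show ?thesis
    using g_top a_top g_step a_step g_le a_ge by (simp add: g_bound_def a_bound_def)
qed

end
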